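(* For every $n\ge 2$ and all complex numbers $x,y$, \[\mathcal{B}_n(x+_My)=\mathcal{B}_n(x)\,\mathcal{M}_n(y)\qquad\text{and}\qquad \mathcal{E}_n(x+_My)=\mathcal{E}_n(x)\,\mathcal{M}_n(y).\]
   Context: The Mersenne numbers are $M_n=2^n-1$ ($n\ge 0$). The $M$-factorial is $M_0!=1$, $M_n!=M_nM_{n-1}!$ for $n\ge1$. The $M$-binomial coefficients are $\binom{n}{k}_M=\frac{M_n!}{M_k!M_{n-k}!}$ for $n\ge k\ge 0$ and $\binom nk_M=0$ for $k>n$. The $M$-exponential is $e_M^{xt}=\sum_{n\ge0}x^n\frac{t^n}{M_n!}$. The Mersenne-Bernoulli and Mersenne-Euler polynomials are defined (as power series in $t$) by $\frac{t e_M^{xt}}{e_M^t-1}=\sum_{n\ge0}B_{n,M}(x)\frac{t^n}{M_n!}$ and $\frac{2 e_M^{xt}}{e_M^t+1}=\sum_{n\ge0}E_{n,M}(x)\frac{t^n}{M_n!}$. The symbol $x+_My$ is umbral: $(x+_My)^n:=\sum_{k=0}^n\binom nk_M x^ky^{n-k}$, and $e_M^{(x+_My)t}:=\sum_{n\ge0}(x+_My)^n\frac{t^n}{M_n!}$. The quantities $B_{n,M}(x+_My)$ and $E_{n,M}(x+_My)$ are defined by $\frac{t e_M^{(x+_My)t}}{e_M^t-1}=\sum_{n\ge0}B_{n,M}(x+_My)\frac{t^n}{M_n!}$ and $\frac{2 e_M^{(x+_My)t}}{e_M^t+1}=\sum_{n\ge0}E_{n,M}(x+_My)\frac{t^n}{M_n!}$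 (equivalently, by replacing each power $X^j$ in the polynomial $B_{n,M}(X)$, respectively $E_{n,M}(X)$, by $(x+_My)^j$). Matrices ($n\times n$, indices $1\le i,j\le n$, all entries $0$ for $i<j$): for $i\ge j$, the Mersenne-Pascal matrix $\mathcal{M}_n(y)$ has entries $\binom{i-1}{j-1}_My^{i-j}$; the Mersenne-Bernoulli matrix $\mathcal{B}_n(x)$ has entries $\binom{i-1}{j-1}_MB_{i-j,M}(x)$; the Mersenne-Euler matrix $\mathcal{E}_n(x)$ has entries $\binom{i-1}{j-1}_ME_{i-j,M}(x)$. $\mathcal{B}_n(x+_My)$ and $\mathcal{E}_n(x+_My)$ have entries $\binom{i-1}{j-1}_MB_{i-j,M}(x+_My)$ and $\binom{i-1}{j-1}_ME_{i-j,M}(x+_My)$ for $i\ge j$. *)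

theory Defs
  imports
    Complex_Main
    "HOL-Computational_Algebra.Formal_Power_Series"
    "Jordan_Normal_Form.Matrix"
begin

definition mersenne :: "nat \<Rightarrow> nat" where
  "mersenne n = 2 ^ n - 1"

fun M_fact :: "nat \<Rightarrow> nat" where
  "M_fact 0 = 1"
| "M_fact (Suc n) = mersenne (Suc n) * M_fact n"

definition M_binomial :: "nat \<Rightarrow> nat \<Rightarrow> complex" where
  "M_binomial n k =
     (if k \<le> n then of_nat (M_fact n) / (of_nat (M_fact k) * of_nat (M_fact (n - k))) else 0)"

text \<open>Generating functions are formal power series in $t$ (\<^term>\<open>fps_X\<close>) over the complex numbers,
  with $x$ and $y$ complex parameters.\<close>

definition M_exp :: "complex \<Rightarrow> complex fps" where
  "M_exp x = Abs_fps (\<lambda>n. x ^ n / of_nat (M_fact n))"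

text \<open>The umbral power $(x +_M y)^n$ and the umbral exponential $e_M^{(x +_M y)t}$.\<close>

definition M_add_power :: "complex \<Rightarrow> complex \<Rightarrow> nat \<Rightarrow> complex" where
  "M_add_power x y n = (\<Sum>k=0..n. M_binomial n k * x ^ k * y ^ (n - k))"

definition M_exp_add :: "complex \<Rightarrow> complex \<Rightarrow> complex fps" where
  "M_exp_add x y = Abs_fps (\<lambda>n. M_add_power x y n / of_nat (M_fact n))"

text \<open>In the Bernoulli case the divisor has subdegree 1; the quotient is exact because of the
  factor $t$ in the dividend (see \<open>M_bernoulli_quotient_exact\<close>).\<close>

definition M_bernoulli :: "nat \<Rightarrow> complex \<Rightarrow> complex" where
  "M_bernoulli n x =
     of_nat (M_fact n) * fps_nth (fps_X * M_exp x / (M_exp 1 - 1)) n"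

definition M_euler :: "nat \<Rightarrow> complex \<Rightarrow> complex" where
  "M_euler n x =
     of_nat (M_fact n) * fps_nth (2 * M_exp x / (M_exp 1 + 1)) n"

definition M_bernoulli_add :: "nat \<Rightarrow> complex \<Rightarrow> complex \<Rightarrow> complex" where
  "M_bernoulli_add n x y =
     of_nat (M_fact n) * fps_nth (fps_X * M_exp_add x y / (M_exp 1 - 1)) n"

definition M_euler_add :: "nat \<Rightarrow> complex \<Rightarrow> complex \<Rightarrow> complex" where
  "M_euler_add n x y =
     of_nat (M_fact n) * fps_nth (2 * M_exp_add x y / (M_exp 1 + 1)) n"

lemma M_bernoulli_quotient_exact:
  "fps_X * F / (M_exp 1 - 1) * (M_exp 1 - 1) = fps_X * F"
proof -
  let ?D = "M_exp 1 - 1"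
  have "fps_nth ?D 0 = 0" "fps_nth ?D 1 \<noteq> 0"
    by (simp_all add: M_exp_def mersenne_def)
  hence "subdegree ?D = 1"
    by (intro subdegreeI) auto
  moreover have "?D \<noteq> 0"
    using \<open>fps_nth ?D 1 \<noteq> 0\<close> by auto
  ultimately have "?D dvd fps_X * F"
    by (cases "F = 0") (auto simp: fps_dvd_iff)
  thus ?thesis by simp
qed

lemma M_euler_quotient_exact:
  "2 * F / (M_exp 1 + 1) * (M_exp 1 + 1) = 2 * F"
proof -
  have "fps_nth (M_exp 1 + 1) 0 \<noteq> 0"
    by (simp add: M_exp_def)
  hence "is_unit (M_exp 1 + 1)"
    by (simp add: fps_is_unit_iff)
  thus ?thesis
    by (meson dvd_div_mult_self unit_imp_dvd)
qed

text \<open>Matrix indices start at 0, so the entry at \<open>(i, j)\<close> is the one the 1-based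
  convention puts at \<open>(i + 1, j + 1)\<close>.\<close>

definition M_pascal_mat :: "nat \<Rightarrow> complex \<Rightarrow> complex mat" where
  "M_pascal_mat n y =
     mat n n (\<lambda>(i, j). if i \<ge> j then M_binomial i j * y ^ (i - j) else 0)"

definition M_bernoulli_mat :: "nat \<Rightarrow> complex \<Rightarrow> complex mat" where
  "M_bernoulli_mat n x =
     mat n n (\<lambda>(i, j). if i \<ge> j then M_binomial i j * M_bernoulli (i - j) x else 0)"

definition M_euler_mat :: "nat \<Rightarrow> complex \<Rightarrow> complex mat" where
  "M_euler_mat n x =
     mat n n (\<lambda>(i, j). if i \<ge> j then M_binomial i j * M_euler (i - j) x else 0)"

definition M_bernoulli_add_mat :: "nat \<Rightarrow> complex \<Rightarrow> complex \<Rightarrow> complex mat" where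
  "M_bernoulli_add_mat n x y =
     mat n n (\<lambda>(i, j). if i \<ge> j then M_binomial i j * M_bernoulli_add (i - j) x y else 0)"

definition M_euler_add_mat :: "nat \<Rightarrow> complex \<Rightarrow> complex \<Rightarrow> complex mat" where
  "M_euler_add_mat n x y =
     mat n n (\<lambda>(i, j). if i \<ge> j then M_binomial i j * M_euler_add (i - j) x y else 0)"

end

theory Submission
  imports Defs
begin

text \<open>The matrix with entries \<open>M_binomial i j * (a (i - j))\<close>, where \<open>a\<close> has the \<open>M\<close>-exponential
  generating function \<open>A\<close>, is the Toeplitz matrix of the coefficients of \<open>A\<close> conjugated by the diagonal
  matrix of the \<open>M\<close>-factorials. So \<open>A\<close> is sent to this matrix multiplicatively, and both
  identities reduce to the factorisation \<open>M_exp_add x y = M_exp x * M_exp y\<close>.\<close>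

lemma M_fact_nonzero: "M_fact n \<noteq> 0"
proof (induction n)
  case (Suc n)
  have "(1::nat) < 2 ^ Suc n"
    by (rule one_less_power) auto
  with Suc show ?case
    by (simp add: mersenne_def)
qed simp

text \<open>Dividing \<open>M_binomial n k\<close> by \<open>M_fact n\<close> leaves
  \<open>1 / (M_fact k * M_fact (n - k))\<close>, so the umbral power is exactly a Cauchy product
  coefficient.\<close>

lemma M_exp_add_eq_mult: "M_exp_add x y = M_exp x * M_exp y"
  by (rule fps_ext)
     (auto simp: M_exp_add_def M_exp_def M_add_power_def M_binomial_def fps_mult_nth
       sum_divide_distrib M_fact_nonzero intro!: sum.cong)

definition M_egf_mat :: "nat \<Rightarrow> complex fps \<Rightarrow> complex mat" where
  "M_egf_mat n A =
     mat n n (\<lambda>(i, j). if i \<ge> j then of_nat (M_fact i) / of_nat (M_fact j) * fps_nth A (i - j) else 0)"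

text \<open>The \<open>M_fact (i - j)\<close> hidden in \<open>f (i - j)\<close> cancels the one in
  the denominator of \<open>M_binomial i j\<close>.\<close>

lemma M_egf_mat_eqI:
  assumes "\<And>k. f k = of_nat (M_fact k) * fps_nth A k"
  shows "mat n n (\<lambda>(i, j). if i \<ge> j then M_binomial i j * f (i - j) else 0) = M_egf_mat n A"
  by (rule eq_matI) (auto simp: M_egf_mat_def M_binomial_def assms M_fact_nonzero)

lemma M_egf_mat_mult: "M_egf_mat n (A * B) = M_egf_mat n A * M_egf_mat n B"
proof (rule eq_matI)
  fix i j
  assume "i < dim_row (M_egf_mat n A * M_egf_mat n B)" "j < dim_col (M_egf_mat n A * M_egf_mat n B)"
  then have ij: "i < n" "j < n"
    by (simp_all add: M_egf_mat_def)
  let ?c = "of_nat (M_fact i) / of_nat (M_fact j) :: complex"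
  let ?g = "\<lambda>k. ?c * (fps_nth A (i - k) * fps_nth B (k - j))"
  \<comment> \<open>Triangularity kills every \<open>k\<close> outside \<open>{j..i}\<close>; in the
    rest \<open>M_fact k\<close> cancels between the two factors. For \<open>i < j\<close> the range
    is empty.\<close>
  have "(M_egf_mat n A * M_egf_mat n B) $$ (i, j) =
      (\<Sum>k\<in>{0..<n}. if k \<in> {j..i} then ?g k else 0)"
    using ij by (auto simp: M_egf_mat_def scalar_prod_def M_fact_nonzero intro!: sum.cong)
  also have "\<dots> = (\<Sum>k\<in>{j..i}. ?g k)"
    using ij by (auto simp: sum.If_cases intro!: sum.cong)
  also have "\<dots> = M_egf_mat n (A * B) $$ (i, j)"
  proof (cases "j \<le> i")
    case True
    \<comment> \<open>The substitution \<open>m = i - k\<close> turns the sum into a Cauchy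
      product.\<close>
    have "(\<Sum>k\<in>{j..i}. ?g k) = (\<Sum>m\<in>{0..i-j}. ?c * (fps_nth A m * fps_nth B (i - j - m)))"
      by (rule sum.reindex_bij_witness[of _ "\<lambda>m. i - m" "\<lambda>k. i - k"]) (use True in auto)
    then show ?thesis
      using True ij by (simp add: M_egf_mat_def fps_mult_nth sum_distrib_left)
  qed (use ij in \<open>simp add: M_egf_mat_def\<close>)
  finally show "M_egf_mat n (A * B) $$ (i, j) = (M_egf_mat n A * M_egf_mat n B) $$ (i, j)" ..
qed (simp_all add: M_egf_mat_def)

lemma M_pascal_mat_eq_egf_mat: "M_pascal_mat n y = M_egf_mat n (M_exp y)"
  unfolding M_pascal_mat_def
  by (rule M_egf_mat_eqI[where f = "\<lambda>k. y ^ k"]) (simp add: M_exp_def M_fact_nonzero)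

text \<open>The divisor has constant term 0 and is no unit, so \<open>G\<close> cannot be moved out
  by inverting it. Both quotients are exact: multiply back and cancel the nonzero divisor.\<close>

lemma M_bernoulli_quotient_mult:
  "fps_X * (F * G) / (M_exp 1 - 1) = fps_X * F / (M_exp 1 - 1) * G"
proof -
  have "fps_nth (M_exp 1 - 1) 1 \<noteq> 0"
    by (simp add: M_exp_def mersenne_def)
  then have "M_exp 1 - 1 \<noteq> 0"
    by auto
  moreover have "fps_X * (F * G) / (M_exp 1 - 1) * (M_exp 1 - 1) =
      (fps_X * F / (M_exp 1 - 1) * G) * (M_exp 1 - 1)"
    by (metis M_bernoulli_quotient_exact mult.assoc mult.commute)
  ultimately show ?thesis
    by simp
qed

lemma M_euler_quotient_mult:
  "2 * (F * G) / (M_exp 1 + 1) = 2 * F / (M_exp 1 + 1) * G"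
proof -
  have "fps_nth (M_exp 1 + 1) 0 \<noteq> 0"
    by (simp add: M_exp_def)
  then have "M_exp 1 + 1 \<noteq> 0"
    by (metis fps_zero_nth)
  moreover have "2 * (F * G) / (M_exp 1 + 1) * (M_exp 1 + 1) =
      (2 * F / (M_exp 1 + 1) * G) * (M_exp 1 + 1)"
    by (metis M_euler_quotient_exact mult.assoc mult.commute)
  ultimately show ?thesis
    by simp
qed

theorem theorem3p3:
  fixes n :: nat and x y :: complex
  assumes "n \<ge> 2"
  shows "M_bernoulli_add_mat n x y = M_bernoulli_mat n x * M_pascal_mat n y
       \<and> M_euler_add_mat n x y = M_euler_mat n x * M_pascal_mat n y"
proof -
  let ?b = "\<lambda>F. fps_X * F / (M_exp 1 - 1)" and ?e = "\<lambda>F. 2 * F / (M_exp 1 + 1)"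
  have "M_bernoulli_mat n x = M_egf_mat n (?b (M_exp x))"
    unfolding M_bernoulli_mat_def
    by (rule M_egf_mat_eqI[where f = "\<lambda>k. M_bernoulli k x"]) (simp add: M_bernoulli_def)
  moreover have "M_bernoulli_add_mat n x y = M_egf_mat n (?b (M_exp x * M_exp y))"
    unfolding M_bernoulli_add_mat_def
    by (rule M_egf_mat_eqI[where f = "\<lambda>k. M_bernoulli_add k x y"])
       (simp add: M_bernoulli_add_def M_exp_add_eq_mult)
  moreover have "M_euler_mat n x = M_egf_mat n (?e (M_exp x))"
    unfolding M_euler_mat_def
    by (rule M_egf_mat_eqI[where f = "\<lambda>k. M_euler k x"]) (simp add: M_euler_def)
  moreover have "M_euler_add_mat n x y = M_egf_mat n (?e (M_exp x * M_exp y))"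
    unfolding M_euler_add_mat_def
    by (rule M_egf_mat_eqI[where f = "\<lambda>k. M_euler_add k x y"])
       (simp add: M_euler_add_def M_exp_add_eq_mult)
  \<comment> \<open>The factor \<open>M_exp y\<close> leaves each quotient on the right and becomes
    the Pascal matrix.\<close>
  ultimately show ?thesis
    by (simp only: M_pascal_mat_eq_egf_mat M_bernoulli_quotient_mult M_euler_quotient_mult
          M_egf_mat_mult simp_thms)
qed

end
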